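(* Let $(X,\mu)$ be a non-atomic probability space, let $k>1$ be an integer, and let $\mathcal{T}$ be a $k$-homogeneous tree on $X$. Let $\phi:X\to[0,\infty)$ be a measurable function such that, for some fixed constants $p>1$ and $c\ge 1$, $$\frac{1}{\mu(I)}\int_I\phi^p\,d\mu\le c\left(\frac{1}{\mu(I)}\int_I\phi\,d\mu\right)^p\qquad\text{for every } I\in\mathcal{T}.$$ Let $\phi^\ast:(0,1]\to[0,\infty)$ be the non-increasing rearrangement of $\phi$. Then $$\frac{1}{t}\int_0^t[\phi^\ast(u)]^p\,du\le(kc-k+1)\left(\frac{1}{t}\int_0^t\phi^\ast(u)\,du\right)^p\qquad\text{for every } t\in(0,1].$$
   Context: A set $\mathcal{T}$ of measurable subsets of $X$ is a $k$-homogeneous tree on $X$ if: (i) $X\in\mathcal{T}$; (ii) to every $I\in\mathcal{T}$ there corresponds a subset $C(I)\subseteq\mathcal{T}$ consisting of $k$ subsets of $I$ such that (a) the elements of $C(I)$ are pairwise disjoint, (b) $I=\bigcup C(I)$, and (c) $\mu(J)=\frac1k\mu(I)$ for every $J\in C(I)$. (Example: $X=[0,1]^n$ with Lebesgue measure and $\mathcal{T}$ the set of all dyadic subcubes, with $k=2^n$.) The non-increasing rearrangement of $\phi$ is $\phi^\ast(t)=\sup_{E\subseteq X,\ \mu(E)=t}\ \inf_{x\in E}|\phi(x)|$ for $t\in(0,1]$, the supremum being over measurable $E$; equivalently, it is the unique left-continuous non-increasing function on $(0,1]$ such that $\mu(\{|\phi|>\lambda\})=|\{\phi^\ast>\lambda\}|$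 for every $\lambda>0$, where $|\cdot|$ is Lebesgue measure.
   Formalization: The tree is additionally assumed to differentiate L^1(X,μ) (averages of each integrable f over tree sets shrinking to x tend to f(x) a.e.); without this the inequality fails, e.g. for the unit square halved only in one coordinate and φ depending on the other. *)

theory Defs
  imports "HOL-Probability.Probability"
begin

definition non_atomic :: "'a measure \<Rightarrow> bool" where
  "non_atomic M \<longleftrightarrow>
    (\<forall>A\<in>sets M. 0 < emeasure M A \<longrightarrow>
      (\<exists>B\<in>sets M. B \<subseteq> A \<and> 0 < emeasure M B \<and> emeasure M B < emeasure M A))"

definition homogeneous_tree :: "nat \<Rightarrow> 'a measure \<Rightarrow> 'a set set \<Rightarrow> bool" where
  "homogeneous_tree k M T \<longleftrightarrow>
    T \<subseteq> sets M \<and> space M \<in> T \<and>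
    (\<forall>I\<in>T. \<exists>C\<subseteq>T. card C = k \<and> (\<forall>J\<in>C. J \<subseteq> I) \<and>
       disjoint C \<and> I = \<Union>C \<and> (\<forall>J\<in>C. measure M J = 1 / real k * measure M I))"

(* T differentiates L^1(M): for integrable f and almost every x, the averages of f over the
   sets I in T containing x converge to f x as the measure of I tends to 0.  A homogeneous tree
   in the sense above need not have this property, and the inequality fails without it.
   Counterexample: on the unit square, halve dyadically in the first coordinate only (k = 2),
   with p = 2, c = 2 and phi(x,y) = 1 + 10 * indicator {y < 1/100}.  The hypothesis holds, but
   at t = 1/10 the conclusion would say 13 <= 3 * 2^2. *)
definition differentiates_L1 :: "'a measure \<Rightarrow> 'a set set \<Rightarrow> bool" where
  "differentiates_L1 M T \<longleftrightarrow>
    (\<forall>f::'a \<Rightarrow> real. integrable M f \<longrightarrow>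
      (AE x in M. \<forall>\<epsilon>>0. \<exists>\<delta>>0. \<forall>I\<in>T. x \<in> I \<and> 0 < measure M I \<and> measure M I < \<delta> \<longrightarrow>
         \<bar>1 / measure M I * (LINT y:I|M. f y) - f x\<bar> < \<epsilon>))"

(* On a non-atomic probability space and for 0 < t <= 1 the supremum is over a nonempty set of
   reals that is bounded above, and no E is empty; other values of t are irrelevant. *)
definition rearrangement :: "'a measure \<Rightarrow> ('a \<Rightarrow> real) \<Rightarrow> real \<Rightarrow> real" where
  "rearrangement M \<phi> t =
    (SUP E\<in>{E \<in> sets M. measure M E = t}. INF x\<in>E. \<bar>\<phi> x\<bar>)"

(* p-th power on [0,\<infinity>], for p > 0. *)
definition enn_powr :: "ennreal \<Rightarrow> real \<Rightarrow> ennreal" where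
  "enn_powr a p = (if a = \<infinity> then \<infinity> else ennreal (enn2real a powr p))"

end

theory Submission
  imports Defs
begin

text \<open>
  Fix t, put \<open>l = \<phi>\<^sup>*(t)\<close> and let \<open>y\<close> be the average of \<open>\<phi>\<^sup>*\<close> over \<open>(0,t]\<close>; the case \<open>y = l\<close> is trivial.
  Let \<open>L\<close> be the secant of \<open>x\<^sup>p\<close> through \<open>l\<close> and \<open>y\<close>, and let \<open>G(x) = x\<^sup>p - L(x)\<close> for \<open>x > l\<close> and
  \<open>G(x) = 0\<close> for \<open>x \<le> l\<close>.  As \<open>L\<close> is affine with \<open>L(y) = y\<^sup>p\<close>, the integral of \<open>(\<phi>\<^sup>*)\<^sup>p\<close> over \<open>(0,t]\<close> is
  \<open>t y\<^sup>p\<close> plus the integral of \<open>G(\<phi>)\<close> over the whole space.  Stop the tree at the first sets \<open>P\<close> that have a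
  child with average above \<open>y\<close>.  Outside them \<open>\<phi> \<le> y\<close> almost everywhere by differentiation, so
  \<open>G(\<phi>) \<le> 0\<close>.  Each \<open>P\<close> has average at most \<open>y\<close> itself, so Jensen's inequality for the convex function
  \<open>x\<^sup>p - G(x)\<close> and the hypothesis on \<open>P\<close> bound the integral of \<open>G(\<phi>)\<close> over \<open>P\<close> by \<open>(c - 1) y\<^sup>p \<mu>(P)\<close>.
  The child with large average gives \<open>(y - l) \<mu>(P) \<le> k \<integral>\<^sub>P max 0 (\<phi> - l)\<close>, and the integral of
  \<open>max 0 (\<phi> - l)\<close> over the whole space is \<open>t (y - l)\<close>.  Summing over \<open>P\<close> gives the constant
  \<open>1 + k (c - 1)\<close>.
\<close>

subsection \<open>Secants of the power function\<close>

text \<open>Convexity of the power function via Young's inequality for \<open>x\<close> and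
  \<open>a powr (p - 1)\<close> with exponents \<open>p\<close> and \<open>q = p / (p - 1)\<close>.
  No derivative is taken, so the boundary cases \<open>a = 0\<close> and \<open>x = 0\<close> are
  included.\<close>

lemma powr_above_tangent:
  fixes a x p :: real
  assumes "1 < p" "0 \<le> a" "0 \<le> x"
  shows "a powr p + p * a powr (p - 1) * (x - a) \<le> x powr p"
proof -
  define q where "q = p / (p - 1)"
  have q: "q > 1" "1 / p + 1 / q = 1" and pq: "p / q = p - 1"
    using assms by (auto simp: q_def field_simps)
  have "x * a powr (p - 1) \<le> x powr p / p + (a powr (p - 1)) powr q / q"
    by (rule Youngs_inequality) (use assms q in auto)
  also have "(a powr (p - 1)) powr q = a powr p"
    using assms by (simp add: powr_powr q_def)
  finally have "p * (x * a powr (p - 1)) \<le> p * (x powr p / p + a powr p / q)"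
    using assms by (intro mult_left_mono) auto
  also have "\<dots> = x powr p + (p / q) * a powr p"
    using assms by (simp add: algebra_simps)
  finally have "p * (x * a powr (p - 1)) \<le> x powr p + (p - 1) * a powr p"
    by (simp only: pq)
  moreover have "a powr p = a * a powr (p - 1)"
    using assms by (cases "a = 0") (simp_all add: powr_diff)
  ultimately show ?thesis
    by (simp add: algebra_simps)
qed

definition secant :: "real \<Rightarrow> real \<Rightarrow> real \<Rightarrow> real \<Rightarrow> real" where
  "secant p a b x = a powr p + (b powr p - a powr p) / (b - a) * (x - a)"

lemma tangent_slope_le_secant_slope:
  fixes a b p :: real
  assumes "1 < p" "0 \<le> a" "a < b"
  shows "p * a powr (p - 1) \<le> (b powr p - a powr p) / (b - a)"
  using powr_above_tangent[of p a b] assms by (simp add: field_simps)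

lemma secant_right: "a < b \<Longrightarrow> secant p a b b = b powr p"
  by (simp add: secant_def)

text \<open>To the left of \<open>a\<close> the steeper line through the same point is the lower
  one: the secant lies below the tangent at \<open>a\<close>, which lies below the power.\<close>

lemma secant_le_powr:
  assumes "1 < p" "0 \<le> a" "a < b" "0 \<le> x" "x \<le> a"
  shows "secant p a b x \<le> x powr p"
proof -
  have "(b powr p - a powr p) / (b - a) * (x - a) \<le> p * a powr (p - 1) * (x - a)"
    using tangent_slope_le_secant_slope[of p a b] assms by (intro mult_right_mono_neg) auto
  then show ?thesis
    using powr_above_tangent[of p a x] assms by (simp add: secant_def)
qed

text \<open>The tangent at \<open>x\<close> is evaluated at \<open>b\<close> and at
  \<open>a\<close>; with weights \<open>x - a\<close> and \<open>b - x\<close> the slope terms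
  cancel, leaving the chord.\<close>

lemma powr_le_secant:
  assumes "1 < p" "0 \<le> a" "a < b" "a \<le> x" "x \<le> b"
  shows "x powr p \<le> secant p a b x"
proof -
  let ?m = "p * x powr (p - 1)"
  have "(x powr p + ?m * (b - x)) * (x - a) \<le> b powr p * (x - a)"
    by (intro mult_right_mono powr_above_tangent) (use assms in auto)
  moreover have "(x powr p + ?m * (a - x)) * (b - x) \<le> a powr p * (b - x)"
    by (intro mult_right_mono powr_above_tangent) (use assms in auto)
  ultimately have "x powr p * (b - a) \<le> a powr p * (b - x) + b powr p * (x - a)"
    by (simp add: algebra_simps)
  also have "\<dots> = secant p a b x * (b - a)"
    using assms by (simp add: secant_def field_simps)
  finally show ?thesis
    using assms by simp
qed

text \<open>At \<open>l\<close> the tangent lies below the power, hence below the secant; beyond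
  \<open>l\<close> the order persists because tangent slopes increase and the one at
  \<open>l\<close> is at most the slope of the secant.\<close>

lemma tangent_le_secant:
  assumes "1 < p" "0 \<le> a" "a \<le> l" "l < b" "l \<le> x"
  shows "a powr p + p * a powr (p - 1) * (x - a) \<le> secant p l b x"
proof -
  have "p * a powr (p - 1) \<le> p * l powr (p - 1)"
    using assms by (intro mult_left_mono powr_mono2) auto
  also have "\<dots> \<le> (b powr p - l powr p) / (b - l)"
    using assms by (intro tangent_slope_le_secant_slope) auto
  finally have "p * a powr (p - 1) * (x - l) \<le> (b powr p - l powr p) / (b - l) * (x - l)"
    using assms by (intro mult_right_mono) auto
  then show ?thesis
    using powr_above_tangent[of p a l] assms by (simp add: secant_def algebra_simps)
qed

text \<open>The function \<open>G\<close> of the overview, with \<open>a = l\<close> and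
  \<open>b = y\<close>. The cut at \<open>a\<close> makes its integral over the whole space equal to
  an integral over \<open>(0,t]\<close>, where the rearrangement is at least
  \<open>l\<close>.\<close>

definition excess :: "real \<Rightarrow> real \<Rightarrow> real \<Rightarrow> real \<Rightarrow> real" where
  "excess p a b x = (if x \<le> a then 0 else x powr p - secant p a b x)"

lemma excess_measurable [measurable]: "excess p a b \<in> borel_measurable borel"
  unfolding excess_def secant_def by measurable

lemma excess_nonpos:
  assumes "1 < p" "0 \<le> a" "a < b" "x \<le> b"
  shows "excess p a b x \<le> 0"
  using powr_le_secant[of p a b x] assms by (auto simp: excess_def)

lemma excess_eq_powr_minus_secant:
  assumes "a \<le> x"
  shows "excess p a b x = x powr p - secant p a b x"
  using assms by (auto simp: excess_def secant_def)

text \<open>The function \<open>x powr p - excess p l b x\<close> follows the power up to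
  \<open>l\<close> and the secant afterwards, and is convex because the slope jumps upwards at
  \<open>l\<close>. Its supporting line at \<open>a\<close> is the tangent if \<open>a < l\<close>
  and the secant otherwise; in the second case the line dominates \<open>a powr p\<close> because
  \<open>a \<le> b\<close>. Integrating this line is the Jensen step.\<close>

lemma excess_supporting_line:
  assumes "1 < p" "0 \<le> l" "l < b" "0 \<le> a" "a \<le> b"
  obtains \<alpha> \<beta> where "\<And>x. 0 \<le> x \<Longrightarrow> excess p l b x \<le> x powr p - (\<alpha> + \<beta> * x)" "a powr p \<le> \<alpha> + \<beta> * a"
proof (cases "a < l")
  case True
  show ?thesis
  proof (rule that[of "a powr p - p * a powr (p - 1) * a" "p * a powr (p - 1)"])
    fix x :: real assume "0 \<le> x"
    then show "excess p l b x \<le> x powr p - (a powr p - p * a powr (p - 1) * a + p * a powr (p - 1) * x)"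
      using powr_above_tangent[of p a x] tangent_le_secant[of p a l b x] assms True
      by (auto simp: excess_def algebra_simps)
  qed simp
next
  case False
  define s where "s = (b powr p - l powr p) / (b - l)"
  have line: "secant p l b x = l powr p - s * l + s * x" for x
    by (simp add: secant_def right_diff_distrib flip: s_def)
  show ?thesis
  proof (rule that[of "l powr p - s * l" s])
    fix x :: real assume "0 \<le> x"
    then show "excess p l b x \<le> x powr p - (l powr p - s * l + s * x)"
      using secant_le_powr[of p l b x] assms by (auto simp: excess_def simp flip: line)
  next
    show "a powr p \<le> l powr p - s * l + s * a"
      using powr_le_secant[of p l b a] assms False by (auto simp flip: line)
  qed
qed

subsection \<open>Subsets of prescribed measure\<close>

context prob_space
begin

text \<open>Greedy filling: the members of \<open>F\<close> are added one at a time, each raising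
  the measure by at most \<open>\<epsilon>\<close>, so the last partial union below \<open>u\<close>
  misses \<open>u\<close> by at most \<open>\<epsilon>\<close>.\<close>

lemma exists_subset_measure_approx:
  assumes "finite F" "F \<subseteq> sets M" "\<And>I. I \<in> F \<Longrightarrow> measure M I \<le> \<epsilon>"
    and "A \<in> sets M" "0 \<le> u" "u \<le> measure M (A \<inter> \<Union>F)" "0 \<le> \<epsilon>"
  shows "\<exists>B\<in>sets M. B \<subseteq> A \<and> u - \<epsilon> \<le> measure M B \<and> measure M B \<le> u"
  using assms
proof (induction F rule: finite_induct)
  case empty
  then show ?case by (intro bexI[of _ "{}"]) auto
next
  case (insert I F)
  show ?case
  proof (cases "u \<le> measure M (A \<inter> \<Union>F)")
    case True
    with insert show ?thesis by auto
  next
    case False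
    have meas: "A \<inter> \<Union>F \<in> sets M" "A \<inter> I \<in> sets M"
      using insert.prems insert.hyps by (auto intro!: sets.Int sets.finite_Union)
    have "u \<le> measure M ((A \<inter> \<Union>F) \<union> (A \<inter> I))"
      using insert.prems by (simp add: Int_Un_distrib Un_commute)
    also have "\<dots> \<le> measure M (A \<inter> \<Union>F) + measure M (A \<inter> I)"
      using meas by (intro measure_Un_le)
    also have "measure M (A \<inter> I) \<le> measure M I"
      using insert.prems by (intro finite_measure_mono) auto
    also have "\<dots> \<le> \<epsilon>"
      using insert.prems by auto
    finally show ?thesis
      using meas False by (intro bexI[of _ "A \<inter> \<Union>F"]) auto
  qed
qed

text \<open>The approximation is repeated inside the remainder \<open>A - B\<close> with target
  \<open>u - measure M B\<close> and halved tolerance. The sets increase, their measures stay below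
  \<open>u\<close> and converge to it, so their union has measure exactly \<open>u\<close>.\<close>

lemma exists_subset_measure_eq:
  assumes fine: "\<And>\<epsilon>. 0 < \<epsilon> \<Longrightarrow>
      \<exists>F. finite F \<and> F \<subseteq> sets M \<and> \<Union>F = space M \<and> (\<forall>I\<in>F. measure M I \<le> \<epsilon>)"
    and A: "A \<in> sets M" and u: "0 \<le> u" "u \<le> measure M A"
  shows "\<exists>B\<in>sets M. B \<subseteq> A \<and> measure M B = u"
proof -
  have approx: "\<exists>B\<in>sets M. B \<subseteq> A' \<and> u' - \<epsilon> \<le> measure M B \<and> measure M B \<le> u'"
    if A': "A' \<in> sets M" "0 \<le> u'" "u' \<le> measure M A'" and \<epsilon>: "0 < \<epsilon>" for A' u' \<epsilon>
  proof -
    obtain F where F: "finite F" "F \<subseteq> sets M" "\<Union>F = space M" "\<And>I. I \<in> F \<Longrightarrow> measure M I \<le> \<epsilon>"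
      using fine[OF \<epsilon>] by metis
    have "A' \<inter> \<Union>F = A'"
      using F(3) sets.sets_into_space[OF A'(1)] by auto
    then show ?thesis
      using exists_subset_measure_approx[OF F(1,2,4) A'(1,2)] A' \<epsilon> by auto
  qed
  let ?P = "\<lambda>n B. B \<in> sets M \<and> B \<subseteq> A \<and> u - (1/2) ^ n \<le> measure M B \<and> measure M B \<le> u"
  have "\<exists>B. \<forall>n. ?P n (B n) \<and> B n \<subseteq> B (Suc n)"
  proof (rule dependent_nat_choice)
    show "\<exists>B. ?P 0 B"
      using approx[OF A u, of 1] by auto
  next
    fix B n assume B: "?P n B"
    have *: "measure M (A - B) = measure M A - measure M B"
      using A B by (intro finite_measure_Diff) auto
    have "\<exists>B'\<in>sets M. B' \<subseteq> A - B \<and> (u - measure M B) - (1/2) ^ Suc n \<le> measure M B'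
        \<and> measure M B' \<le> u - measure M B"
      using A B u * by (intro approx) auto
    then obtain B' where B': "B' \<in> sets M" "B' \<subseteq> A - B"
      "(u - measure M B) - (1/2) ^ Suc n \<le> measure M B'" "measure M B' \<le> u - measure M B"
      by blast
    have "measure M (B \<union> B') = measure M B + measure M B'"
      using B B' by (intro finite_measure_Union) auto
    with B B' have "?P (Suc n) (B \<union> B') \<and> B \<subseteq> B \<union> B'"
      by auto
    then show "\<exists>B'. ?P (Suc n) B' \<and> B \<subseteq> B'"
      by blast
  qed
  then obtain B where P: "\<And>n. ?P n (B n)" and step: "\<And>n. B n \<subseteq> B (Suc n)"
    by blast
  have "(\<lambda>n. measure M (B n)) \<longlonglongrightarrow> measure M (\<Union>n. B n)"
    using P step by (intro finite_Lim_measure_incseq) (auto intro!: incseq_SucI)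
  moreover have "(\<lambda>n. measure M (B n)) \<longlonglongrightarrow> u"
  proof (rule tendsto_sandwich[where h = "\<lambda>_. u"])
    show "(\<lambda>n. u - (1/2) ^ n) \<longlonglongrightarrow> u"
      using tendsto_diff[OF tendsto_const LIMSEQ_power_zero[of "1/2::real"], of u] by simp
  qed (use P in \<open>auto intro!: always_eventually tendsto_const\<close>)
  ultimately have "measure M (\<Union>n. B n) = u"
    by (rule LIMSEQ_unique)
  with P show ?thesis
    by (intro bexI[of _ "\<Union>n. B n"]) auto
qed

end

subsection \<open>The non-increasing rearrangement\<close>

text \<open>The supremum in \<open>rearrangement\<close> runs over sets of one exact measure.
  Subsets of every smaller measure make these sets available and let larger sets be shrunk to
  competitors.\<close>

locale divisible_prob_space = prob_space +
  fixes \<phi> :: "'a \<Rightarrow> real"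
  assumes subset_measure: "\<lbrakk>A \<in> sets M; 0 \<le> u; u \<le> measure M A\<rbrakk> \<Longrightarrow> \<exists>B\<in>sets M. B \<subseteq> A \<and> measure M B = u"
    and \<phi>_meas [measurable]: "\<phi> \<in> borel_measurable M"
    and \<phi>_nonneg: "\<And>x. x \<in> space M \<Longrightarrow> 0 \<le> \<phi> x"
begin

text \<open>The sets where \<open>\<phi>\<close> exceeds \<open>n\<close> decrease to the empty set,
  so one of them has measure below \<open>u\<close>. Any competitor \<open>E\<close> then has a
  point with value at most \<open>n\<close>.\<close>

lemma bdd_above_INF:
  assumes "0 < u"
  shows "bdd_above ((\<lambda>E. INF x\<in>E. \<bar>\<phi> x\<bar>) ` {E \<in> sets M. measure M E = u})"
proof -
  have "(\<lambda>n. measure M {x \<in> space M. \<phi> x > real n}) \<longlonglongrightarrow> measure M (\<Inter>n. {x \<in> space M. \<phi> x > real n})"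
    by (intro finite_Lim_measure_decseq) (auto simp: decseq_def)
  also have "(\<Inter>n. {x \<in> space M. \<phi> x > real n}) = {}"
  proof -
    have "\<exists>n. \<phi> x \<le> real n" for x
      by (rule real_arch_simple)
    then show ?thesis by (auto simp: not_less[symmetric])
  qed
  finally have "eventually (\<lambda>n. measure M {x \<in> space M. \<phi> x > real n} < u) sequentially"
    using assms by (intro order_tendstoD(2)) auto
  then have "\<exists>n. measure M {x \<in> space M. \<phi> x > real n} < u"
    using eventually_happens'[OF trivial_limit_sequentially] by blast
  then obtain n where n: "measure M {x \<in> space M. \<phi> x > real n} < u" ..
  have "(INF x\<in>E. \<bar>\<phi> x\<bar>) \<le> real n" if E: "E \<in> sets M" "measure M E = u" for E
  proof -
    have "\<not> E \<subseteq> {x \<in> space M. \<phi> x > real n}"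
      using n E finite_measure_mono[of E "{x \<in> space M. \<phi> x > real n}"] by auto
    then obtain x where x: "x \<in> E" "\<phi> x \<le> real n" "x \<in> space M"
      using sets.sets_into_space[OF E(1)] by force
    have "(INF x\<in>E. \<bar>\<phi> x\<bar>) \<le> \<bar>\<phi> x\<bar>"
      by (rule cINF_lower) (use x in \<open>auto intro!: bdd_belowI[of _ 0]\<close>)
    also have "\<dots> \<le> real n"
      using x \<phi>_nonneg by auto
    finally show ?thesis .
  qed
  then show ?thesis
    by (intro bdd_aboveI) auto
qed

text \<open>A subset of \<open>E\<close> of measure exactly \<open>u\<close> inherits the lower
  bound and competes in the supremum.\<close>

lemma rearrangement_ge:
  assumes "0 < u" "E \<in> sets M" "u \<le> measure M E" "\<And>x. x \<in> E \<Longrightarrow> s \<le> \<phi> x"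
  shows "s \<le> rearrangement M \<phi> u"
proof -
  obtain B where B: "B \<in> sets M" "B \<subseteq> E" "measure M B = u"
    using subset_measure[of E u] assms by auto
  have "s \<le> (INF x\<in>B. \<bar>\<phi> x\<bar>)"
  proof (rule cINF_greatest)
    show "B \<noteq> {}" using B assms by auto
    show "s \<le> \<bar>\<phi> x\<bar>" if "x \<in> B" for x
      using assms(4)[of x] that B by auto
  qed
  also have "\<dots> \<le> rearrangement M \<phi> u"
    unfolding rearrangement_def using B assms by (intro cSUP_upper bdd_above_INF) auto
  finally show ?thesis .
qed

lemma rearrangement_greaterD:
  assumes "0 < u" "u \<le> 1" "s < rearrangement M \<phi> u"
  shows "u \<le> measure M {x \<in> space M. s < \<phi> x}"
proof -
  have "\<exists>B\<in>sets M. B \<subseteq> space M \<and> measure M B = u"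
    using assms prob_space by (intro subset_measure) auto
  then have "{E \<in> sets M. measure M E = u} \<noteq> {}" by auto
  then obtain E where E: "E \<in> sets M" "measure M E = u" "s < (INF x\<in>E. \<bar>\<phi> x\<bar>)"
    using assms(3) less_cSUP_iff[OF _ bdd_above_INF[OF assms(1)]]
    unfolding rearrangement_def by auto
  have "s < \<phi> x" if "x \<in> E" for x
  proof -
    have "(INF x\<in>E. \<bar>\<phi> x\<bar>) \<le> \<bar>\<phi> x\<bar>"
      by (rule cINF_lower) (use that in \<open>auto intro!: bdd_belowI[of _ 0]\<close>)
    then show ?thesis
      using E(3) \<phi>_nonneg[of x] that sets.sets_into_space[OF E(1)] by auto
  qed
  then show ?thesis
    using E sets.sets_into_space[OF E(1)] by (auto intro!: finite_measure_mono)
qed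

text \<open>The infimum over a set where \<open>\<phi>\<close> exceeds \<open>s\<close> may equal
  \<open>s\<close>. The levels \<open>s + 1 / Suc n\<close> leave a gap, and their superlevel sets
  increase to the one of \<open>s\<close>, so one of them still has measure above
  \<open>u\<close>.\<close>

lemma rearrangement_greaterI:
  assumes "0 < u" "u < measure M {x \<in> space M. s < \<phi> x}"
  shows "s < rearrangement M \<phi> u"
proof -
  have "(\<lambda>n. measure M {x \<in> space M. s + 1 / Suc n \<le> \<phi> x}) \<longlonglongrightarrow>
      measure M (\<Union>n. {x \<in> space M. s + 1 / Suc n \<le> \<phi> x})"
  proof (intro finite_Lim_measure_incseq incseq_SucI subsetI)
    fix n x assume "x \<in> {x \<in> space M. s + 1 / Suc n \<le> \<phi> x}"
    moreover have "1 / real (Suc (Suc n)) \<le> 1 / Suc n" by (simp add: field_simps)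
    ultimately show "x \<in> {x \<in> space M. s + 1 / Suc (Suc n) \<le> \<phi> x}" by auto
  qed auto
  also have "(\<Union>n. {x \<in> space M. s + 1 / Suc n \<le> \<phi> x}) = {x \<in> space M. s < \<phi> x}"
  proof -
    have "\<exists>n. s + 1 / Suc n \<le> \<phi> x" if "s < \<phi> x" for x
    proof -
      obtain n where "inverse (real (Suc n)) < \<phi> x - s"
        using reals_Archimedean[of "\<phi> x - s"] \<open>s < \<phi> x\<close> by (auto simp del: of_nat_Suc)
      then have "s + 1 / Suc n \<le> \<phi> x"
        unfolding inverse_eq_divide by linarith
      then show ?thesis ..
    qed
    moreover have "s < \<phi> x" if "s + 1 / Suc n \<le> \<phi> x" for n x
    proof -
      have "0 < 1 / real (Suc n)" by simp
      with that show ?thesis by linarith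
    qed
    ultimately show ?thesis by auto
  qed
  finally have "eventually (\<lambda>n. u < measure M {x \<in> space M. s + 1 / Suc n \<le> \<phi> x}) sequentially"
    using assms(2) by (rule order_tendstoD(1))
  then obtain n where n: "u < measure M {x \<in> space M. s + 1 / Suc n \<le> \<phi> x}"
    by (metis (no_types, lifting) eventually_happens trivial_limit_sequentially)
  have "s + 1 / Suc n \<le> rearrangement M \<phi> u"
    by (rule rearrangement_ge[where E = "{x \<in> space M. s + 1 / Suc n \<le> \<phi> x}"]) (use assms n in auto)
  moreover have "0 < 1 / real (Suc n)" by simp
  ultimately show ?thesis by linarith
qed

lemma rearrangement_nonneg: "0 < u \<Longrightarrow> u \<le> 1 \<Longrightarrow> 0 \<le> rearrangement M \<phi> u"
  using \<phi>_nonneg prob_space by (intro rearrangement_ge[where E = "space M"]) auto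

lemma rearrangement_antimono:
  assumes "0 < u" "u \<le> v" "v \<le> 1"
  shows "rearrangement M \<phi> v \<le> rearrangement M \<phi> u"
proof (rule dense_le)
  fix s assume "s < rearrangement M \<phi> v"
  then have "v \<le> measure M {x \<in> space M. s < \<phi> x}"
    using assms by (intro rearrangement_greaterD) auto
  then show "s \<le> rearrangement M \<phi> u"
    using assms by (intro rearrangement_ge[where E = "{x \<in> space M. s < \<phi> x}"]) auto
qed

section \<open>Equimeasurability of the function and its rearrangement\<close>

abbreviation unit_interval :: "real measure" where
  "unit_interval \<equiv> restrict_space lborel {0<..1}"

text \<open>The two criteria for \<open>s < rearrangement M \<phi> u\<close> decide every
  \<open>u\<close> except \<open>u = d s\<close>. Leaving that endpoint open is harmless, since both
  intervals have length \<open>d s\<close>.\<close>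

lemma rearrangement_superlevel:
  defines "d s \<equiv> measure M {x \<in> space M. s < \<phi> x}"
  shows "{u \<in> {0<..1}. s < rearrangement M \<phi> u} \<in> {{0<..<d s}, {0<..d s}}"
proof (cases "d s \<in> {0<..1} \<and> s < rearrangement M \<phi> (d s)")
  case True
  have "{u \<in> {0<..1}. s < rearrangement M \<phi> u} = {0<..d s}"
  proof (intro equalityI subsetI)
    fix u assume "u \<in> {0<..d s}"
    then show "u \<in> {u \<in> {0<..1}. s < rearrangement M \<phi> u}"
      using True rearrangement_antimono[of u "d s"] by auto
  qed (auto simp: d_def dest: rearrangement_greaterD)
  then show ?thesis by simp
next
  case False
  have "u < d s" if "u \<in> {0<..1}" "s < rearrangement M \<phi> u" for u
    using rearrangement_greaterD[of u s] that False by (cases "u = d s") (auto simp: d_def)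
  moreover have "u \<in> {0<..1} \<and> s < rearrangement M \<phi> u" if "u \<in> {0<..<d s}" for u
  proof -
    have "d s \<le> 1" by (simp add: d_def)
    with that have "0 < u" "u \<le> 1" by auto
    with that show ?thesis
      using rearrangement_greaterI[of u s] unfolding d_def by simp
  qed
  ultimately have "{u \<in> {0<..1}. s < rearrangement M \<phi> u} = {0<..<d s}"
    by auto
  then show ?thesis by simp
qed

lemma rearrangement_measurable [measurable]: "rearrangement M \<phi> \<in> borel_measurable unit_interval"
  unfolding borel_measurable_iff_greater
proof
  fix s
  have "{u \<in> {0<..1}. s < rearrangement M \<phi> u} \<in> sets borel"
    using rearrangement_superlevel[of s]
    by (metis (no_types, lifting) empty_iff greaterThanAtMost_borel greaterThanLessThan_borel insert_iff)
  then show "{u \<in> space unit_interval. s < rearrangement M \<phi> u} \<in> sets unit_interval"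
    by (subst sets_restrict_space_iff) (auto simp: space_restrict_space)
qed

lemma prob_space_unit_interval: "prob_space unit_interval"
  by (intro prob_spaceI) (simp add: space_restrict_space emeasure_restrict_space)

text \<open>Superlevel sets have equal measure on both sides, so by complements the distribution
  functions agree. Equality of the laws then transfers the integral of any Borel function of
  \<open>\<phi>\<close>.\<close>

lemma distr_rearrangement: "distr unit_interval borel (rearrangement M \<phi>) = distr M borel \<phi>"
proof (rule cdf_unique)
  interpret U: prob_space unit_interval by (rule prob_space_unit_interval)
  show "real_distribution (distr unit_interval borel (rearrangement M \<phi>))"
    by (rule U.real_distribution_distr) measurable
  show "real_distribution (distr M borel \<phi>)"
    by simp
  show "cdf (distr unit_interval borel (rearrangement M \<phi>)) = cdf (distr M borel \<phi>)"
  proof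
    fix s
    let ?S = "{u \<in> {0<..1}. s < rearrangement M \<phi> u}"
    let ?d = "measure M {x \<in> space M. s < \<phi> x}"
    have sets: "?S \<in> sets unit_interval"
      using measurable_sets[OF rearrangement_measurable, of "{s<..}"]
      by (simp add: space_restrict_space vimage_def Int_def conj_commute)
    have "measure unit_interval ?S = measure lborel ?S"
      by (rule measure_restrict_space) auto
    also have "\<dots> = ?d"
    proof -
      have "?S = {0<..<?d} \<or> ?S = {0<..?d}"
        using rearrangement_superlevel[of s] by (simp only: insert_iff empty_iff simp_thms)
      then show ?thesis
      proof
        assume eq: "?S = {0<..<?d}"
        show ?thesis unfolding eq by (simp add: measure_def)
      next
        assume eq: "?S = {0<..?d}"
        show ?thesis unfolding eq by (simp add: measure_def)
      qed
    qed
    finally have S: "measure unit_interval ?S = ?d" .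
    have "cdf (distr unit_interval borel (rearrangement M \<phi>)) s
        = measure unit_interval (space unit_interval - ?S)"
      unfolding cdf_def
      by (subst measure_distr)
        (auto simp: space_restrict_space intro!: arg_cong2[where f = measure])
    also have "\<dots> = 1 - ?d"
      using U.prob_compl[OF sets] S by simp
    also have "\<dots> = measure M (space M - {x \<in> space M. s < \<phi> x})"
      by (subst prob_compl) auto
    also have "\<dots> = cdf (distr M borel \<phi>) s"
      unfolding cdf_def
      by (subst measure_distr) (auto intro!: arg_cong2[where f = measure])
    finally show "cdf (distr unit_interval borel (rearrangement M \<phi>)) s = cdf (distr M borel \<phi>) s" .
  qed
qed

lemma nn_integral_rearrangement:
  assumes [measurable]: "F \<in> borel_measurable borel"
  shows "(\<integral>\<^sup>+u\<in>{0<..1}. F (rearrangement M \<phi> u) \<partial>lborel) = (\<integral>\<^sup>+x. F (\<phi> x) \<partial>M)"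
proof -
  have "(\<integral>\<^sup>+u\<in>{0<..1}. F (rearrangement M \<phi> u) \<partial>lborel) = (\<integral>\<^sup>+u. F (rearrangement M \<phi> u) \<partial>unit_interval)"
    by (subst nn_integral_restrict_space) auto
  also have "\<dots> = (\<integral>\<^sup>+z. F z \<partial>distr unit_interval borel (rearrangement M \<phi>))"
    by (subst nn_integral_distr) auto
  also have "\<dots> = (\<integral>\<^sup>+x. F (\<phi> x) \<partial>M)"
    unfolding distr_rearrangement by (subst nn_integral_distr) auto
  finally show ?thesis .
qed

lemma
  fixes F :: "real \<Rightarrow> real"
  assumes [measurable]: "F \<in> borel_measurable borel"
  shows integral_rearrangement:
      "(LINT u|unit_interval. F (rearrangement M \<phi> u)) = (LINT x|M. F (\<phi> x))"
    and integrable_rearrangement_iff: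
      "integrable unit_interval (\<lambda>u. F (rearrangement M \<phi> u)) \<longleftrightarrow> integrable M (\<lambda>x. F (\<phi> x))"
proof -
  have "(LINT u|unit_interval. F (rearrangement M \<phi> u)) = (LINT z|distr unit_interval borel (rearrangement M \<phi>). F z)"
    by (rule integral_distr[symmetric]) auto
  also have "\<dots> = (LINT x|M. F (\<phi> x))"
    unfolding distr_rearrangement by (rule integral_distr) auto
  finally show "(LINT u|unit_interval. F (rearrangement M \<phi> u)) = (LINT x|M. F (\<phi> x))" .
  have "integrable unit_interval (\<lambda>u. F (rearrangement M \<phi> u)) \<longleftrightarrow>
      integrable (distr unit_interval borel (rearrangement M \<phi>)) F"
    by (rule integrable_distr_eq[symmetric]) auto
  also have "\<dots> \<longleftrightarrow> integrable M (\<lambda>x. F (\<phi> x))"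
    unfolding distr_rearrangement by (rule integrable_distr_eq) auto
  finally show "integrable unit_interval (\<lambda>u. F (rearrangement M \<phi> u)) \<longleftrightarrow> integrable M (\<lambda>x. F (\<phi> x))" .
qed

lemma nn_integral_initial_segment:
  assumes "0 < t" "t \<le> 1" "integrable unit_interval f" "\<And>u. u \<in> {0<..t} \<Longrightarrow> 0 \<le> f u"
  shows "(\<integral>\<^sup>+u\<in>{0<..t}. ennreal (f u) \<partial>lborel) = ennreal (LINT u:{0<..t}|unit_interval. f u)"
proof -
  have "(\<integral>\<^sup>+u\<in>{0<..t}. ennreal (f u) \<partial>lborel)
      = (\<integral>\<^sup>+u\<in>{0<..1}. ennreal (f u) * indicator {0<..t} u \<partial>lborel)"
    using assms by (intro nn_integral_cong) (auto simp: indicator_def)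
  also have "\<dots> = (\<integral>\<^sup>+u\<in>{0<..t}. ennreal (f u) \<partial>unit_interval)"
    by (subst nn_integral_restrict_space) auto
  also have "\<dots> = ennreal (LINT u:{0<..t}|unit_interval. f u)"
    using assms by (intro nn_set_integral_eq_set_integral) (auto simp: sets_restrict_space_iff)
  finally show ?thesis .
qed

text \<open>Beyond \<open>t\<close> the rearrangement is at most its value at \<open>t\<close>,
  which adds only a finite amount; an infinite integral must therefore come from
  \<open>(0,t]\<close>.\<close>

lemma nn_integral_rearrangement_infinite:
  assumes t: "0 < t" "t \<le> 1" and inf: "(\<integral>\<^sup>+x. ennreal (\<phi> x) \<partial>M) = \<infinity>"
  shows "(\<integral>\<^sup>+u\<in>{0<..t}. ennreal (rearrangement M \<phi> u) \<partial>lborel) = \<infinity>"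
proof (rule ccontr)
  let ?\<psi> = "rearrangement M \<phi>"
  assume fin: "(\<integral>\<^sup>+u\<in>{0<..t}. ennreal (?\<psi> u) \<partial>lborel) \<noteq> \<infinity>"
  have "\<infinity> = (\<integral>\<^sup>+u\<in>{0<..1}. ennreal (?\<psi> u) \<partial>lborel)"
    using nn_integral_rearrangement[of ennreal] inf by simp
  also have "\<dots> = (\<integral>\<^sup>+u. ennreal (?\<psi> u) \<partial>unit_interval)"
    by (subst nn_integral_restrict_space) auto
  also have "\<dots> \<le> (\<integral>\<^sup>+u. ennreal (?\<psi> u) * indicator {0<..t} u + ennreal (?\<psi> t) \<partial>unit_interval)"
    using t rearrangement_antimono[of t]
    by (intro nn_integral_mono) (auto simp: indicator_def space_restrict_space intro!: ennreal_leI)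
  also have "\<dots> = (\<integral>\<^sup>+u. ennreal (?\<psi> u) * indicator {0<..t} u \<partial>unit_interval) + ennreal (?\<psi> t)"
    using t prob_space.emeasure_space_1[OF prob_space_unit_interval]
    by (subst nn_integral_add) (auto simp: sets_restrict_space_iff intro!: borel_measurable_times_ennreal borel_measurable_indicator)
  also have "(\<integral>\<^sup>+u. ennreal (?\<psi> u) * indicator {0<..t} u \<partial>unit_interval)
      = (\<integral>\<^sup>+u\<in>{0<..t}. ennreal (?\<psi> u) \<partial>lborel)"
    using t by (subst nn_integral_restrict_space) (auto intro!: nn_integral_cong simp: indicator_def)
  finally show False
    using fin by (simp add: top_unique)
qed

end

subsection \<open>Stopping the tree\<close>

lemma set_integrable_of_integrable:
  fixes f :: "'a \<Rightarrow> real"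
  assumes "integrable M f" "A \<in> sets M"
  shows "set_integrable M A f"
  using assms unfolding set_integrable_def by (rule integrable_mult_indicator[rotated])

text \<open>Finite partial unions have nonpositive integral by additivity, and continuity of the
  integral along increasing sets carries the sign to the limit.\<close>

lemma set_integral_countable_Union_nonpos:
  fixes f :: "'a \<Rightarrow> real"
  assumes F: "countable F" "disjoint F" "F \<subseteq> sets M" and f: "integrable M f"
    and nonpos: "\<And>P. P \<in> F \<Longrightarrow> (LINT x:P|M. f x) \<le> 0"
  shows "(LINT x:\<Union>F|M. f x) \<le> 0"
proof -
  \<comment> \<open>An enumeration of \<open>F\<close> padded with empty sets, so that finite
    families also give a sequence. Distinct indices yield distinct members of \<open>F\<close> or at
    least one empty set, hence disjointness.\<close>
  define A where "A n = (if n \<in> to_nat_on F ` F then from_nat_into F n else {})" for n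
  have A_cases: "A n = {} \<or> A n \<in> F" for n
    using F(1) by (auto simp: A_def)
  have Un: "(\<Union>n. A n) = \<Union>F"
  proof (intro equalityI subsetI)
    fix x assume "x \<in> \<Union>F"
    then obtain P where "x \<in> P" "P \<in> F" by auto
    then have "x \<in> A (to_nat_on F P)"
      using F(1) by (auto simp: A_def)
    then show "x \<in> (\<Union>n. A n)" by auto
  qed (use A_cases in fastforce)
  have A_sets: "A n \<in> sets M" for n
    using A_cases[of n] F(3) by auto
  have disj: "A i \<inter> A j = {}" if "i \<noteq> j" for i j
  proof (cases "A i \<in> F \<and> A j \<in> F \<and> A i \<noteq> A j")
    case True
    with F(2) show ?thesis by (auto dest: disjointD)
  next
    case False
    have "A i = {} \<or> A j = {}"
    proof (rule ccontr)
      assume *: "\<not> ?thesis"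
      then obtain P Q where "P \<in> F" "i = to_nat_on F P" "Q \<in> F" "j = to_nat_on F Q"
        unfolding A_def by (metis imageE)
      with F(1) have "P = A i" "Q = A j" "P \<in> F" "Q \<in> F" "P \<noteq> Q"
        using that by (auto simp: A_def)
      with False show False by simp
    qed
    then show ?thesis by auto
  qed
  have "(\<lambda>n. LINT x:(\<Union>i<n. A i)|M. f x) \<longlonglongrightarrow> (LINT x:(\<Union>n. \<Union>i<n. A i)|M. f x)"
  proof (rule set_integral_cont_up)
    show "incseq (\<lambda>n. \<Union>i<n. A i)" unfolding incseq_def by (intro allI impI UN_mono) auto
    show "set_integrable M (\<Union>n. \<Union>i<n. A i) f"
      using A_sets by (intro set_integrable_of_integrable[OF f]) auto
  qed (use A_sets in auto)
  moreover have "(LINT x:(\<Union>i<n. A i)|M. f x) \<le> 0" for n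
  proof -
    have "(LINT x:(\<Union>i<n. A i)|M. f x) = (\<Sum>i<n. LINT x:A i|M. f x)"
      using A_sets disj by (intro set_integral_finite_Union) (auto simp: disjoint_family_on_def intro!: set_integrable_of_integrable[OF f])
    also have "\<dots> \<le> 0"
    proof (rule sum_nonpos)
      fix i show "(LINT x:A i|M. f x) \<le> 0"
        using A_cases[of i] nonpos[of "A i"] by (elim disjE) (simp_all add: set_lebesgue_integral_def)
    qed
    finally show ?thesis .
  qed
  ultimately have "(LINT x:(\<Union>n. \<Union>i<n. A i)|M. f x) \<le> 0"
    by (intro LIMSEQ_le_const2) auto
  moreover have "(\<Union>n. \<Union>i<n. A i) = (\<Union>n. A n)" by blast
  ultimately show ?thesis using Un by simp
qed

section \<open>Levels of a homogeneous tree\<close>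

locale tree_with_children = prob_space +
  fixes k :: nat and T :: "'a set set" and C :: "'a set \<Rightarrow> 'a set set"
  assumes k_gt_1: "1 < k" and T_sets: "T \<subseteq> sets M" and space_in_T: "space M \<in> T"
    and children_T: "I \<in> T \<Longrightarrow> C I \<subseteq> T"
    and card_children: "I \<in> T \<Longrightarrow> card (C I) = k"
    and disjoint_children: "I \<in> T \<Longrightarrow> disjoint (C I)"
    and Union_children: "I \<in> T \<Longrightarrow> \<Union>(C I) = I"
    and measure_child: "I \<in> T \<Longrightarrow> J \<in> C I \<Longrightarrow> measure M J = measure M I / real k"
begin

text \<open>\<open>T\<close> may contain sets that are not reached from the root through
  \<open>C\<close>. The levels single out the descendants of the root, whose measures are powers of
  \<open>1 / k\<close> and thus positive.\<close>

primrec level :: "nat \<Rightarrow> 'a set set" where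
  "level 0 = {space M}"
| "level (Suc n) = (\<Union>I\<in>level n. C I)"

lemma level_T: "level n \<subseteq> T"
  using space_in_T children_T by (induction n) auto

lemma level_sets: "I \<in> level n \<Longrightarrow> I \<in> sets M"
  using level_T T_sets by blast

lemma finite_level: "finite (level n)"
proof (induction n)
  case (Suc n)
  have "finite (C I)" if "I \<in> level n" for I
    using card_children[OF subsetD[OF level_T that]] k_gt_1 by (intro card_ge_0_finite) simp
  with Suc show ?case by auto
qed simp

lemma Union_level: "\<Union>(level n) = space M"
proof (induction n)
  case (Suc n)
  have "\<Union>(level (Suc n)) = (\<Union>I\<in>level n. \<Union>(C I))" by auto
  also have "\<dots> = \<Union>(level n)"
    using Union_children level_T by (intro SUP_cong[where D = "\<lambda>x. x", simplified]) blast+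
  finally show ?case using Suc by simp
qed simp

lemma child_subset: "I \<in> T \<Longrightarrow> J \<in> C I \<Longrightarrow> J \<subseteq> I"
  using Union_children by blast

lemma disjoint_level: "disjoint (level n)"
proof (induction n)
  case (Suc n)
  show ?case
  proof (rule disjointI)
    fix a b assume ab: "a \<in> level (Suc n)" "b \<in> level (Suc n)" "a \<noteq> b"
    then obtain I J where IJ: "I \<in> level n" "a \<in> C I" "J \<in> level n" "b \<in> C J" by auto
    have sub: "a \<subseteq> I" "b \<subseteq> J"
      using child_subset IJ level_T by blast+
    show "a \<inter> b = {}"
    proof (cases "I = J")
      case True
      with IJ ab disjoint_children[of I] level_T show ?thesis
        by (auto dest: disjointD)
    next
      case False
      with IJ Suc have "I \<inter> J = {}" by (auto dest: disjointD)
      with sub show ?thesis by auto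
    qed
  qed
qed simp

lemma measure_level: "I \<in> level n \<Longrightarrow> measure M I = 1 / real k ^ n"
proof (induction n arbitrary: I)
  case (Suc n)
  then obtain J where "J \<in> level n" "I \<in> C J" by auto
  with Suc.IH[of J] measure_child[of J I] level_T show ?case by (auto simp: field_simps)
qed (simp add: prob_space)

lemma measure_level_pos: "I \<in> level n \<Longrightarrow> 0 < measure M I"
  using measure_level k_gt_1 by simp

lemma ancestor: "P \<in> level n \<Longrightarrow> m \<le> n \<Longrightarrow> \<exists>Q\<in>level m. P \<subseteq> Q"
proof (induction n arbitrary: P)
  case (Suc n)
  show ?case
  proof (cases "m = Suc n")
    case False
    obtain J where J: "J \<in> level n" "P \<in> C J" using Suc by auto
    then obtain Q where "Q \<in> level m" "J \<subseteq> Q" using Suc False by (metis le_Suc_eq)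
    with J child_subset[of J P] level_T show ?thesis by blast
  qed (use Suc in auto)
qed auto

lemma level_measure_small:
  assumes "0 < \<epsilon>"
  obtains n where "0 < n" "\<And>I. I \<in> level n \<Longrightarrow> measure M I < \<epsilon>"
proof -
  obtain n where n: "(1 / real k) ^ n < \<epsilon>"
    using real_arch_pow_inv[OF assms, of "1 / real k"] k_gt_1 by auto
  \<comment> \<open>One level more than the estimate asks for makes the index positive, so that
    every set of that level has a parent.\<close>
  have "(1 / real k) ^ Suc n \<le> (1 / real k) ^ n"
    using k_gt_1 by (intro power_decreasing) auto
  with n have "1 / real k ^ Suc n < \<epsilon>" by (simp add: power_one_over)
  then show ?thesis
    using measure_level[of _ "Suc n"] by (intro that[of "Suc n"]) auto
qed

section \<open>Maximal bad sets\<close>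

definition stopped :: "('a set \<Rightarrow> bool) \<Rightarrow> 'a set set" where
  "stopped bad = {P. \<exists>n. P \<in> level n \<and> bad P \<and> (\<forall>m<n. \<forall>Q\<in>level m. P \<subseteq> Q \<longrightarrow> \<not> bad Q)}"

lemma stopped_sets: "stopped bad \<subseteq> sets M"
  using level_sets by (auto simp: stopped_def)

lemma countable_stopped: "countable (stopped bad)"
proof (rule countable_subset)
  show "stopped bad \<subseteq> (\<Union>n. level n)" by (auto simp: stopped_def)
  show "countable (\<Union>n. level n)" using finite_level by (auto intro: countable_finite)
qed

text \<open>Distinct sets of one level are disjoint. For different levels, the ancestor of the
  deeper set at the level of the other one is not bad, so it differs from that other set and is
  disjoint from it.\<close>

lemma disjoint_stopped: "disjoint (stopped bad)"
proof -
  have *: "P \<inter> P' = {}"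
    if P: "P \<in> level n" "bad P" and P': "P' \<in> level n'" "\<And>m Q. m < n' \<Longrightarrow> Q \<in> level m \<Longrightarrow> P' \<subseteq> Q \<Longrightarrow> \<not> bad Q"
      and "P \<noteq> P'" "n \<le> n'" for P P' n n'
  proof (cases "n = n'")
    case True
    with that disjoint_level[of n] show ?thesis by (intro disjointD) auto
  next
    case False
    then obtain Q where Q: "Q \<in> level n" "P' \<subseteq> Q"
      using ancestor[OF P'(1), of n] \<open>n \<le> n'\<close> by auto
    then have "Q \<noteq> P" using P P'(2)[of n Q] False \<open>n \<le> n'\<close> by auto
    then have "Q \<inter> P = {}" using Q(1) P(1) disjoint_level by (auto dest: disjointD)
    with Q show ?thesis by auto
  qed
  show ?thesis
  proof (rule disjointI)
    fix a b assume a: "a \<in> stopped bad" and b: "b \<in> stopped bad" and "a \<noteq> b"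
    obtain n where n: "a \<in> level n" "bad a" "\<And>m Q. m < n \<Longrightarrow> Q \<in> level m \<Longrightarrow> a \<subseteq> Q \<Longrightarrow> \<not> bad Q"
      using a by (auto simp: stopped_def)
    obtain m where m: "b \<in> level m" "bad b" "\<And>i Q. i < m \<Longrightarrow> Q \<in> level i \<Longrightarrow> b \<subseteq> Q \<Longrightarrow> \<not> bad Q"
      using b by (auto simp: stopped_def)
    show "a \<inter> b = {}"
    proof (cases "n \<le> m")
      case True
      then show ?thesis using *[OF n(1,2) m(1,3)] \<open>a \<noteq> b\<close> by auto
    next
      case False
      then have "b \<inter> a = {}" using *[OF m(1,2) n(1,3)] \<open>a \<noteq> b\<close> by auto
      then show ?thesis by auto
    qed
  qed
qed

text \<open>All earlier sets containing \<open>Q\<close> also contain \<open>x\<close>, so by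
  induction they are not bad; a bad \<open>Q\<close> would then be stopped.\<close>

lemma not_bad_outside_stopped:
  assumes "x \<notin> \<Union>(stopped bad)" "x \<in> Q" "Q \<in> level n"
  shows "\<not> bad Q"
  using assms(2,3)
proof (induction n arbitrary: Q rule: less_induct)
  case (less n)
  then have *: "\<forall>m<n. \<forall>Q'\<in>level m. Q \<subseteq> Q' \<longrightarrow> \<not> bad Q'" by blast
  show ?case
  proof
    assume "bad Q"
    with * less.prems(2) have "Q \<in> stopped bad" unfolding stopped_def by blast
    with less.prems(1) assms(1) show False by blast
  qed
qed

section \<open>Averages and the integral of the excess\<close>

definition avg :: "('a \<Rightarrow> real) \<Rightarrow> 'a set \<Rightarrow> real" where
  "avg f I = 1 / measure M I * (LINT x:I|M. f x)"

lemma avg_nonneg: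
  assumes "\<And>x. x \<in> space M \<Longrightarrow> 0 \<le> f x" "I \<in> sets M"
  shows "0 \<le> avg f I"
  unfolding avg_def set_lebesgue_integral_def
  by (intro mult_nonneg_nonneg Bochner_Integration.integral_nonneg) (auto simp: indicator_def assms(1))

text \<open>The supporting line at the average of \<open>\<phi>\<close> is integrated over
  \<open>P\<close>, which subtracts at least \<open>avg \<phi> P powr p * measure M P\<close> from
  the integral of the power. The reverse Hoelder bound on \<open>P\<close> leaves the factor
  \<open>c - 1\<close>, and as this is nonnegative the average may be replaced by
  \<open>y\<close>.\<close>

lemma set_integral_excess_le:
  fixes \<phi> :: "'a \<Rightarrow> real"
  assumes "1 < p" "0 \<le> l" "l < y" and P: "P \<in> sets M" "0 < measure M P"
    and avg: "0 \<le> avg \<phi> P" "avg \<phi> P \<le> y" and "1 \<le> c"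
    and nonneg: "\<And>x. x \<in> space M \<Longrightarrow> 0 \<le> \<phi> x"
    and int: "integrable M \<phi>" "integrable M (\<lambda>x. \<phi> x powr p)" "integrable M (\<lambda>x. excess p l y (\<phi> x))"
    and RH: "(LINT x:P|M. \<phi> x powr p) \<le> c * avg \<phi> P powr p * measure M P"
  shows "(LINT x:P|M. excess p l y (\<phi> x)) \<le> (c - 1) * y powr p * measure M P"
proof -
  note set_int = int[THEN set_integrable_of_integrable, OF P(1)]
  obtain \<alpha> \<beta> where line: "\<And>x. 0 \<le> x \<Longrightarrow> excess p l y x \<le> x powr p - (\<alpha> + \<beta> * x)"
    and touch: "avg \<phi> P powr p \<le> \<alpha> + \<beta> * avg \<phi> P"
    using excess_supporting_line[OF assms(1-3) avg] by blast
  have const: "set_integrable M P (\<lambda>x. \<alpha>)" "(LINT x:P|M. \<alpha>) = measure M P * \<alpha>"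
    using P by (auto intro!: set_integrable_of_integrable simp: set_integral_const)
  have "(LINT x:P|M. excess p l y (\<phi> x)) \<le> (LINT x:P|M. \<phi> x powr p - (\<alpha> + \<beta> * \<phi> x))"
    using line nonneg sets.sets_into_space[OF P(1)]
    by (intro set_integral_mono set_integral_diff set_integral_add set_integrable_mult_right set_int const) auto
  also have "\<dots> = (LINT x:P|M. \<phi> x powr p) - (measure M P * \<alpha> + \<beta> * (LINT x:P|M. \<phi> x))"
    using set_int const by (simp add: set_integral_diff set_integral_add)
  also have "(LINT x:P|M. \<phi> x) = avg \<phi> P * measure M P"
    using P by (simp add: avg_def)
  also have "(LINT x:P|M. \<phi> x powr p) - (measure M P * \<alpha> + \<beta> * (avg \<phi> P * measure M P))
      \<le> c * avg \<phi> P powr p * measure M P - (\<alpha> + \<beta> * avg \<phi> P) * measure M P"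
    using RH by (simp add: algebra_simps)
  also have "\<dots> \<le> c * avg \<phi> P powr p * measure M P - avg \<phi> P powr p * measure M P"
    using touch P by (simp add: mult_right_mono)
  also have "\<dots> = (c - 1) * avg \<phi> P powr p * measure M P"
    by (simp add: algebra_simps)
  also have "\<dots> \<le> (c - 1) * y powr p * measure M P"
    using assms by (intro mult_right_mono mult_left_mono powr_mono2) auto
  finally show ?thesis .
qed

text \<open>Subtracting \<open>K * max 0 (\<phi> x - l)\<close> from the excess makes the estimate
  local: the difference has nonpositive integral on each stopped set and is nonpositive almost
  everywhere outside them.\<close>

lemma integral_excess_le:
  fixes \<phi> :: "'a \<Rightarrow> real"
  assumes p: "1 < p" and l: "0 \<le> l" "l < y" and c: "1 \<le> c"
    and nonneg: "\<And>x. x \<in> space M \<Longrightarrow> 0 \<le> \<phi> x"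
    and int: "integrable M \<phi>" "integrable M (\<lambda>x. \<phi> x powr p)"
    and RH: "\<And>I n. I \<in> level n \<Longrightarrow> (LINT x:I|M. \<phi> x powr p) \<le> c * avg \<phi> I powr p * measure M I"
    and conv: "AE x in M. \<forall>\<epsilon>>0. \<exists>\<delta>>0. \<forall>I\<in>T. x \<in> I \<and> 0 < measure M I \<and> measure M I < \<delta> \<longrightarrow>
         \<bar>avg \<phi> I - \<phi> x\<bar> < \<epsilon>"
    and mean: "expectation \<phi> \<le> y"
  shows "integrable M (\<lambda>x. excess p l y (\<phi> x))" (is ?int)
    and "expectation (\<lambda>x. excess p l y (\<phi> x))
      \<le> real k * (c - 1) * y powr p / (y - l) * expectation (\<lambda>x. max 0 (\<phi> x - l))" (is ?le)
proof -
  have [measurable]: "\<phi> \<in> borel_measurable M"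
    using int(1) by (rule borel_measurable_integrable)
  have "integrable M (\<lambda>x. \<phi> x powr p - secant p l y (\<phi> x))"
    unfolding secant_def using int by simp
  then have ind: "integrable M (\<lambda>x. indicator {x \<in> space M. l < \<phi> x} x *\<^sub>R (\<phi> x powr p - secant p l y (\<phi> x)))"
    by (intro integrable_mult_indicator) auto
  have "integrable M (\<lambda>x. excess p l y (\<phi> x)) \<longleftrightarrow>
      integrable M (\<lambda>x. indicator {x \<in> space M. l < \<phi> x} x *\<^sub>R (\<phi> x powr p - secant p l y (\<phi> x)))"
    by (intro Bochner_Integration.integrable_cong) (auto simp: excess_def)
  with ind show exc: ?int by blast
  have pos: "integrable M (\<lambda>x. max 0 (\<phi> x - l))"
    using int by (intro integrable_max) auto
  define K where "K = real k * (c - 1) * y powr p / (y - l)"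
  have K: "0 \<le> K" using c l by (simp add: K_def)
  \<comment> \<open>Badness looks at the children, so a stopped set itself still has average at most
    \<open>y\<close>: it is the root, covered by \<open>mean\<close>, or a child of a set that is
    not bad.\<close>
  define bad where "bad I \<longleftrightarrow> (\<exists>J\<in>C I. y < avg \<phi> J)" for I
  let ?D = "\<Union>(stopped bad)"
  have D: "?D \<in> sets M"
    using countable_stopped stopped_sets by (intro sets.countable_Union) auto
  let ?f = "\<lambda>x. excess p l y (\<phi> x) - K * max 0 (\<phi> x - l)"
  have f: "integrable M ?f"
    using exc pos by simp
  have "(LINT x:?D|M. ?f x) \<le> 0"
  proof (rule set_integral_countable_Union_nonpos[OF countable_stopped disjoint_stopped stopped_sets f])
    fix P assume "P \<in> stopped bad"
    then obtain n where n: "P \<in> level n" "bad P" "\<And>m Q. m < n \<Longrightarrow> Q \<in> level m \<Longrightarrow> P \<subseteq> Q \<Longrightarrow> \<not> bad Q"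
      by (auto simp: stopped_def)
    have P: "P \<in> sets M" "0 < measure M P" "P \<in> T"
      using level_sets[OF n(1)] measure_level_pos[OF n(1)] subsetD[OF level_T n(1)] by auto
    have avgP: "avg \<phi> P \<le> y"
    proof (cases n)
      case 0
      with n mean show ?thesis by (simp add: avg_def prob_space set_integral_space int)
    next
      case (Suc m)
      then obtain Q where Q: "Q \<in> level m" "P \<in> C Q" using n by auto
      then have "P \<subseteq> Q" using child_subset subsetD[OF level_T] by auto
      then have "\<not> bad Q" using n(3)[OF _ Q(1)] Suc by simp
      with Q show ?thesis by (auto simp: bad_def not_less)
    qed
    obtain J where J: "J \<in> C P" "y < avg \<phi> J" using n by (auto simp: bad_def)
    have Jsets: "J \<in> sets M" and JP: "J \<subseteq> P" and mJ: "measure M J = measure M P / real k"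
      using subsetD[OF children_T[OF P(3)] J(1)] T_sets child_subset[OF P(3) J(1)] measure_child[OF P(3) J(1)]
      by auto
    have mJ_pos: "0 < measure M J" using mJ P k_gt_1 by simp
    have const: "set_integrable M J (\<lambda>x. l)"
      using Jsets by (intro set_integrable_of_integrable) auto
    \<comment> \<open>The positive part of \<open>\<phi> - l\<close> over \<open>P\<close> is
      bounded below by its share on the child \<open>J\<close>. Since \<open>J\<close> has the
      \<open>k\<close>-th part of the measure of \<open>P\<close>, this is where the factor
      \<open>k\<close> enters.\<close>
    have "(y - l) * measure M J \<le> (avg \<phi> J - l) * measure M J"
      using J mJ_pos by (intro mult_right_mono) auto
    also have "\<dots> = (LINT x:J|M. \<phi> x) - (LINT x:J|M. l)"
      using mJ_pos Jsets by (simp add: avg_def set_integral_const algebra_simps)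
    also have "\<dots> = (LINT x:J|M. \<phi> x - l)"
      using set_integral_diff(2)[OF set_integrable_of_integrable[OF int(1) Jsets] const] by simp
    also have "\<dots> \<le> (LINT x:P|M. max 0 (\<phi> x - l))"
      unfolding set_lebesgue_integral_def
      using JP Jsets P int pos
      by (intro integral_mono integrable_mult_indicator) (auto simp: indicator_def)
    finally have big: "(y - l) * measure M P \<le> real k * (LINT x:P|M. max 0 (\<phi> x - l))"
      using k_gt_1 mJ by (simp add: field_simps)
    have "(c - 1) * y powr p * measure M P = (c - 1) * y powr p / (y - l) * ((y - l) * measure M P)"
      using l by simp
    also have "\<dots> \<le> (c - 1) * y powr p / (y - l) * (real k * (LINT x:P|M. max 0 (\<phi> x - l)))"
      using c l by (intro mult_left_mono big) auto
    also have "\<dots> = K * (LINT x:P|M. max 0 (\<phi> x - l))"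
      by (simp add: K_def)
    finally have "(LINT x:P|M. excess p l y (\<phi> x)) \<le> K * (LINT x:P|M. max 0 (\<phi> x - l))"
      using set_integral_excess_le[OF p l P(1,2) avg_nonneg[OF nonneg P(1)] avgP c nonneg int exc RH[OF n(1)]]
      by linarith
    then show "(LINT x:P|M. ?f x) \<le> 0"
      using set_integrable_of_integrable[OF exc P(1)] set_integrable_of_integrable[OF pos P(1)]
      by (simp add: set_integral_diff)
  qed
  moreover have "expectation ?f \<le> (LINT x:?D|M. ?f x)"
    unfolding set_lebesgue_integral_def
  proof (rule integral_mono_AE)
    show "integrable M (\<lambda>x. indicator ?D x *\<^sub>R ?f x)"
      using D f by (rule integrable_mult_indicator)
    show "AE x in M. ?f x \<le> indicator ?D x *\<^sub>R ?f x"
      using conv AE_space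
    proof eventually_elim
      case (elim x)
      show ?case
      proof (cases "x \<in> ?D")
        case False
        have "\<phi> x \<le> y"
        proof (rule ccontr)
          assume "\<not> \<phi> x \<le> y"
          \<comment> \<open>With \<open>\<phi> x - y\<close> as tolerance, differentiation forces
            averages above \<open>y\<close> on all small tree sets around \<open>x\<close>. A small
            level set containing \<open>x\<close> has a parent that is not bad, so its average is at
            most \<open>y\<close>.\<close>
          then have "0 < \<phi> x - y" by simp
          then obtain \<delta> where \<delta>: "0 < \<delta>"
            "\<And>I. I \<in> T \<Longrightarrow> x \<in> I \<Longrightarrow> 0 < measure M I \<Longrightarrow> measure M I < \<delta> \<Longrightarrow> \<bar>avg \<phi> I - \<phi> x\<bar> < \<phi> x - y"
            using elim(1)[rule_format, of "\<phi> x - y"] by auto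
          obtain n where n: "0 < n" "\<And>I. I \<in> level n \<Longrightarrow> measure M I < \<delta>"
            using level_measure_small[OF \<delta>(1)] by blast
          obtain m where m: "n = Suc m" using n(1) by (cases n) auto
          obtain J where J: "J \<in> level n" "x \<in> J"
            using Union_level[of n] elim(2) by blast
          then obtain Q where Q: "Q \<in> level m" "J \<in> C Q" using m by auto
          have "x \<in> Q" using child_subset[OF subsetD[OF level_T Q(1)] Q(2)] J(2) by auto
          then have "\<not> bad Q" using not_bad_outside_stopped[OF False _ Q(1)] by simp
          then have "avg \<phi> J \<le> y" using Q(2) by (auto simp: bad_def not_less)
          moreover have "\<bar>avg \<phi> J - \<phi> x\<bar> < \<phi> x - y"
            by (intro \<delta>(2) subsetD[OF level_T J(1)] J(2) measure_level_pos[OF J(1)] n(2)[OF J(1)])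
          ultimately show False by linarith
        qed
        then have "excess p l y (\<phi> x) \<le> 0"
          using p l by (intro excess_nonpos) auto
        moreover have "0 \<le> K * max 0 (\<phi> x - l)" using K by simp
        ultimately show ?thesis using False by simp
      qed simp
    qed
  qed (rule f)
  ultimately have "expectation ?f \<le> 0" by simp
  then show ?le
    using exc pos by (simp add: K_def)
qed

end

subsection \<open>The reverse Hoelder inequality\<close>

lemma enn_powr_ennreal: "0 \<le> a \<Longrightarrow> enn_powr (ennreal a) p = ennreal (a powr p)"
  by (simp add: enn_powr_def)

context divisible_prob_space
begin

text \<open>The two hypotheses on the excess are what the stopping argument yields for
  \<open>K = k * (c - 1)\<close>. They are required for all admissible \<open>l\<close> and
  \<open>y\<close>, and are used with the value of the rearrangement at \<open>t\<close> and its
  mean over \<open>(0,t]\<close>.\<close>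

lemma rearrangement_reverse_Holder:
  assumes p: "1 < p" and K: "0 \<le> K" and t: "0 < t" "t \<le> 1"
    and int: "integrable M \<phi>" "integrable M (\<lambda>x. \<phi> x powr p)"
    and exc_int: "\<And>l y. 0 \<le> l \<Longrightarrow> l < y \<Longrightarrow> expectation \<phi> \<le> y \<Longrightarrow> integrable M (\<lambda>x. excess p l y (\<phi> x))"
    and exc_le: "\<And>l y. 0 \<le> l \<Longrightarrow> l < y \<Longrightarrow> expectation \<phi> \<le> y \<Longrightarrow>
      expectation (\<lambda>x. excess p l y (\<phi> x)) \<le> K * y powr p / (y - l) * expectation (\<lambda>x. max 0 (\<phi> x - l))"
  shows "(LINT u:{0<..t}|unit_interval. rearrangement M \<phi> u powr p) / t
    \<le> (K + 1) * ((LINT u:{0<..t}|unit_interval. rearrangement M \<phi> u) / t) powr p"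
proof -
  interpret U: prob_space unit_interval by (rule prob_space_unit_interval)
  define S where "S = {0<..t}"
  define \<psi> where "\<psi> = rearrangement M \<phi>"
  define l where "l = \<psi> t"
  define y where "y = (LINT u:S|unit_interval. \<psi> u) / t"
  have S: "S \<in> sets unit_interval"
    using t by (auto simp: S_def sets_restrict_space_iff)
  have mS: "measure unit_interval S = t"
    using t by (subst measure_restrict_space) (auto simp: S_def)
  have [measurable]: "\<psi> \<in> borel_measurable unit_interval"
    unfolding \<psi>_def by (rule rearrangement_measurable)
  have l: "0 \<le> l"
    using rearrangement_nonneg t by (simp add: l_def \<psi>_def)
  have ge: "l \<le> \<psi> u" if "u \<in> S" for u
    using rearrangement_antimono[of u t] that t by (simp add: l_def \<psi>_def S_def)
  have le: "\<psi> u \<le> l" if "u \<in> space unit_interval" "u \<notin> S" for u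
    using rearrangement_antimono[of t u] that t by (auto simp: l_def \<psi>_def S_def space_restrict_space)
  have int': "integrable unit_interval \<psi>" "integrable unit_interval (\<lambda>u. \<psi> u powr p)"
    using int integrable_rearrangement_iff[of "\<lambda>x. x"] integrable_rearrangement_iff[of "\<lambda>x. x powr p"]
    by (simp_all add: \<psi>_def)
  note set_int = int'[THEN set_integrable_of_integrable, OF S]
  have const: "set_integrable unit_interval S (\<lambda>u. a)" "(LINT u:S|unit_interval. a) = t * a" for a :: real
    using S mS by (auto intro!: set_integrable_of_integrable simp: set_integral_const)
  have "(LINT u:S|unit_interval. \<psi> u - l) = (LINT u:S|unit_interval. \<psi> u) - (LINT u:S|unit_interval. l)"
    by (rule set_integral_diff(2)[OF set_int(1) const(1)])
  also have "\<dots> = t * (y - l)"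
    using t by (simp add: const y_def algebra_simps)
  finally have above: "(LINT u:S|unit_interval. \<psi> u - l) = t * (y - l)" .
  have "(LINT u:S|unit_interval. l) \<le> (LINT u:S|unit_interval. \<psi> u)"
    by (rule set_integral_mono[OF const(1) set_int(1) ge])
  then have "l \<le> y"
    using t by (simp add: const y_def field_simps)
  have "(LINT u:S|unit_interval. \<psi> u powr p) \<le> t * ((K + 1) * y powr p)"
  proof (cases "l < y")
    case False
    with \<open>l \<le> y\<close> have "y = l" by simp
    have ind: "integrable unit_interval (\<lambda>u. indicator S u *\<^sub>R (\<psi> u - l))"
      using int' S by (intro integrable_mult_indicator) auto
    \<comment> \<open>On \<open>S\<close> the function \<open>\<psi> - l\<close> is nonnegative, and
      for \<open>y = l\<close> its integral vanishes, so \<open>\<psi>\<close> is almost everywhere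
      the constant \<open>l\<close> there.\<close>
    have "AE u in unit_interval. indicator S u *\<^sub>R (\<psi> u - l) = 0"
      using above \<open>y = l\<close> ge
      by (subst integral_nonneg_eq_0_iff_AE[OF ind, symmetric])
        (auto simp: set_lebesgue_integral_def indicator_def)
    then have "(LINT u:S|unit_interval. \<psi> u powr p) = (LINT u:S|unit_interval. l powr p)"
      using S by (intro set_lebesgue_integral_cong_AE) (auto elim!: eventually_mono simp: indicator_def)
    also have "\<dots> = t * y powr p"
      by (simp add: const \<open>y = l\<close>)
    also have "\<dots> \<le> t * ((K + 1) * y powr p)"
      using K t by (intro mult_left_mono) (auto simp: algebra_simps)
    finally show ?thesis .
  next
    case True
    \<comment> \<open>Off \<open>S\<close> the rearrangement is at most \<open>l\<close>, so the
      positive part lives on \<open>S\<close>, where it equals \<open>\<psi> - l\<close>.\<close>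
    have "expectation (\<lambda>x. max 0 (\<phi> x - l)) = (LINT u|unit_interval. max 0 (\<psi> u - l))"
      unfolding \<psi>_def by (rule integral_rearrangement[symmetric]) measurable
    also have "\<dots> = (LINT u:S|unit_interval. \<psi> u - l)"
      unfolding set_lebesgue_integral_def
    proof (intro Bochner_Integration.integral_cong refl)
      fix u assume "u \<in> space unit_interval"
      then show "max 0 (\<psi> u - l) = indicator S u *\<^sub>R (\<psi> u - l)"
        using ge[of u] le[of u] by (cases "u \<in> S") auto
    qed
    finally have pos: "expectation (\<lambda>x. max 0 (\<phi> x - l)) = t * (y - l)"
      by (simp add: above)
    \<comment> \<open>The stopping argument needs the mean over the whole space to be at most
      \<open>y\<close>; it is at most \<open>l + t * (y - l)\<close>, and
      \<open>t \<le> 1\<close>.\<close>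
    have "expectation \<phi> \<le> expectation (\<lambda>x. l + max 0 (\<phi> x - l))"
      using int by (intro integral_mono) auto
    also have "\<dots> = l + t * (y - l)"
      using int by (subst Bochner_Integration.integral_add) (auto simp: pos prob_space)
    also have "\<dots> \<le> l + 1 * (y - l)"
      using t True by (intro add_left_mono mult_right_mono) auto
    finally have mean: "expectation \<phi> \<le> y" by simp
    define s where "s = (y powr p - l powr p) / (y - l)"
    have secant: "secant p l y z = l powr p + s * (z - l)" for z
      by (simp add: secant_def s_def)
    have above_int: "set_integrable unit_interval S (\<lambda>u. \<psi> u - l)"
      by (rule set_integral_diff(1)[OF set_int(1) const(1)])
    have "expectation (\<lambda>x. excess p l y (\<phi> x)) = (LINT u|unit_interval. excess p l y (\<psi> u))"
      unfolding \<psi>_def by (rule integral_rearrangement[symmetric]) measurable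
    \<comment> \<open>The formula on \<open>S\<close> includes points with
      \<open>\<psi> u = l\<close>, where power and secant agree; off \<open>S\<close> the excess is
      zero.\<close>
    also have "\<dots> = (LINT u:S|unit_interval. \<psi> u powr p - secant p l y (\<psi> u))"
      unfolding set_lebesgue_integral_def
    proof (intro Bochner_Integration.integral_cong refl)
      fix u assume u: "u \<in> space unit_interval"
      show "excess p l y (\<psi> u) = indicator S u *\<^sub>R (\<psi> u powr p - secant p l y (\<psi> u))"
      proof (cases "u \<in> S")
        case True
        then show ?thesis using excess_eq_powr_minus_secant[OF ge] by simp
      next
        case False
        then show ?thesis using le[OF u] by (simp add: excess_def)
      qed
    qed
    also have "\<dots> = (LINT u:S|unit_interval. \<psi> u powr p) - (t * l powr p + s * (t * (y - l)))"
      unfolding secant using above_int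
      by (subst set_integral_diff(2)) (auto simp: set_int const above set_integral_add(2) intro!: set_integral_add(1))
    \<comment> \<open>The secant is affine and \<open>y\<close> is the mean of \<open>\<psi>\<close>
      over \<open>S\<close>, so its integral is \<open>t\<close> times its value at
      \<open>y\<close>.\<close>
    also have "t * l powr p + s * (t * (y - l)) = t * secant p l y y"
      by (simp add: secant algebra_simps)
    also have "secant p l y y = y powr p"
      using True by (rule secant_right)
    finally have "(LINT u:S|unit_interval. \<psi> u powr p) = t * y powr p + expectation (\<lambda>x. excess p l y (\<phi> x))"
      by simp
    also have "\<dots> \<le> t * y powr p + K * y powr p / (y - l) * (t * (y - l))"
      using exc_le[OF l True mean] by (simp add: pos)
    also have "\<dots> = t * ((K + 1) * y powr p)"
      using True by (simp add: field_simps)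
    finally show ?thesis .
  qed
  then show ?thesis
    using t by (simp add: divide_le_eq mult.commute flip: S_def \<psi>_def y_def)
qed

end

section \<open>Assembling the proof with extended nonnegative integrals\<close>

theorem mainTheorem2:
  fixes M :: "'a measure" and T :: "'a set set" and k :: nat
    and \<phi> :: "'a \<Rightarrow> real" and p c :: real
  assumes "prob_space M"
    and "non_atomic M"
    and "k > 1"
    and "homogeneous_tree k M T"
    and "differentiates_L1 M T"
    and "\<phi> \<in> borel_measurable M"
    and "\<forall>x\<in>space M. 0 \<le> \<phi> x"
    and "p > 1" and "c \<ge> 1"
    and "\<forall>I\<in>T. (\<integral>\<^sup>+x\<in>I. ennreal (\<phi> x powr p) \<partial>M) / emeasure M I
           \<le> ennreal c * enn_powr ((\<integral>\<^sup>+x\<in>I. ennreal (\<phi> x) \<partial>M) / emeasure M I) p"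
  shows "\<forall>t\<in>{0<..1}.
           (\<integral>\<^sup>+u\<in>{0<..t}. ennreal (rearrangement M \<phi> u powr p) \<partial>lborel) / ennreal t
           \<le> ennreal (real k * c - real k + 1) *
             enn_powr ((\<integral>\<^sup>+u\<in>{0<..t}. ennreal (rearrangement M \<phi> u) \<partial>lborel) / ennreal t) p"
proof -
  note tree = assms(4)[unfolded homogeneous_tree_def]
  note RH = assms(10)
  have nonneg: "\<And>x. x \<in> space M \<Longrightarrow> 0 \<le> \<phi> x" using assms(7) by blast
  \<comment> \<open>The tree asserts children for each set separately; a choice function fixes them
    once, so that levels can be defined by recursion.\<close>
  obtain C where C: "\<forall>I\<in>T. C I \<subseteq> T \<and> card (C I) = k \<and> (\<forall>J\<in>C I. J \<subseteq> I) \<and>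
       disjoint (C I) \<and> I = \<Union>(C I) \<and> (\<forall>J\<in>C I. measure M J = 1 / real k * measure M I)"
    using bchoice[OF tree[THEN conjunct2, THEN conjunct2]] by (elim exE)
  interpret prob_space M by fact
  interpret tree_with_children M k T C
  proof
    show "1 < k" "T \<subseteq> sets M" "space M \<in> T" using \<open>k > 1\<close> tree by auto
    fix I assume "I \<in> T"
    note CI = bspec[OF C this]
    show "C I \<subseteq> T" "card (C I) = k" "disjoint (C I)" using CI by simp_all
    show "\<Union>(C I) = I" using CI by (elim conjE) (rule sym)
    show "measure M J = measure M I / real k" if "J \<in> C I" for J
      using CI that by (elim conjE) auto
  qed
  interpret divisible_prob_space M \<phi>
  proof
    fix A u assume A: "A \<in> sets M" "0 \<le> u" "u \<le> measure M A"
    show "\<exists>B\<in>sets M. B \<subseteq> A \<and> measure M B = u"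
    proof (rule exists_subset_measure_eq[OF _ A])
      \<comment> \<open>The levels of the tree are finite covers of the space by sets of arbitrarily
        small measure.\<close>
      fix \<epsilon> :: real assume "0 < \<epsilon>"
      then obtain n where "\<And>I. I \<in> level n \<Longrightarrow> measure M I < \<epsilon>"
        using level_measure_small by blast
      then show "\<exists>F. finite F \<and> F \<subseteq> sets M \<and> \<Union>F = space M \<and> (\<forall>I\<in>F. measure M I \<le> \<epsilon>)"
        using finite_level[of n] level_sets[of _ n] Union_level[of n]
        by (intro exI[of _ "level n"]) (auto intro: less_imp_le)
    qed
  qed (use assms in auto)
  define K where "K = real k * (c - 1)"
  have K: "0 \<le> K" using \<open>c \<ge> 1\<close> by (simp add: K_def)
  have K1: "real k * c - real k + 1 = K + 1" by (simp add: K_def algebra_simps)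
  show ?thesis
  proof (intro ballI)
    fix t :: real assume "t \<in> {0<..1}"
    then have t: "0 < t" "t \<le> 1" by auto
    show "(\<integral>\<^sup>+u\<in>{0<..t}. ennreal (rearrangement M \<phi> u powr p) \<partial>lborel) / ennreal t
           \<le> ennreal (real k * c - real k + 1) *
             enn_powr ((\<integral>\<^sup>+u\<in>{0<..t}. ennreal (rearrangement M \<phi> u) \<partial>lborel) / ennreal t) p"
    proof (cases "(\<integral>\<^sup>+x. ennreal (\<phi> x) \<partial>M) = \<infinity>")
      case True
      \<comment> \<open>The right-hand side is infinite: the factor \<open>K + 1\<close> is
        positive, so the product with infinity does not collapse to zero.\<close>
      have "ennreal (K + 1) * enn_powr (\<infinity> / ennreal t) p = \<infinity>"
        using K t by (simp add: enn_powr_def ennreal_top_divide ennreal_mult_top)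
      then show ?thesis
        unfolding K1 nn_integral_rearrangement_infinite[OF t True] by simp
    next
      case False
      have int1: "integrable M \<phi>"
        using nonneg False by (intro integrableI_nonneg) (auto simp: less_top)
      have nn1: "(\<integral>\<^sup>+x\<in>I. ennreal (\<phi> x) \<partial>M) = ennreal (LINT x:I|M. \<phi> x)" if "I \<in> sets M" for I
        using that nonneg by (intro nn_set_integral_eq_set_integral int1) auto
      have RH': "(\<integral>\<^sup>+x\<in>I. ennreal (\<phi> x powr p) \<partial>M) / ennreal (measure M I)
          \<le> ennreal (c * avg \<phi> I powr p)" if I: "I \<in> level n" for I n
      proof -
        have sets: "I \<in> sets M" and pos: "0 < measure M I" and IT: "I \<in> T"
          using level_sets[OF I] measure_level_pos[OF I] subsetD[OF level_T I] by auto
        have int_nonneg: "0 \<le> (LINT x:I|M. \<phi> x)"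
          using avg_nonneg[OF nonneg sets] pos by (simp add: avg_def zero_le_divide_iff)
        have "(\<integral>\<^sup>+x\<in>I. ennreal (\<phi> x) \<partial>M) / emeasure M I = ennreal (avg \<phi> I)"
          using nn1[OF sets] pos int_nonneg by (simp add: emeasure_eq_measure divide_ennreal avg_def)
        then show ?thesis
          using RH[rule_format, OF IT] avg_nonneg[OF nonneg sets] \<open>c \<ge> 1\<close>
          by (simp add: enn_powr_ennreal emeasure_eq_measure ennreal_mult)
      qed
      \<comment> \<open>Integrability of the \<open>p\<close>-th power comes from the hypothesis at
        the root, where the average of \<open>\<phi>\<close> is already known to be finite.\<close>
      have "(\<integral>\<^sup>+x. ennreal (\<phi> x powr p) \<partial>M) \<le> ennreal (c * avg \<phi> (space M) powr p)"
        using RH'[of "space M" 0] by (simp add: prob_space divide_ennreal_def)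
      also have "\<dots> < \<infinity>" by simp
      finally have "(\<integral>\<^sup>+x. ennreal (\<phi> x powr p) \<partial>M) < \<infinity>" .
      then have int2: "integrable M (\<lambda>x. \<phi> x powr p)"
        by (intro integrableI_nonneg) auto
      have RH_real: "(LINT x:I|M. \<phi> x powr p) \<le> c * avg \<phi> I powr p * measure M I" if I: "I \<in> level n" for I n
      proof -
        have sets: "I \<in> sets M" and pos: "0 < measure M I"
          using level_sets[OF I] measure_level_pos[OF I] by auto
        have "(\<integral>\<^sup>+x\<in>I. ennreal (\<phi> x powr p) \<partial>M) = ennreal (LINT x:I|M. \<phi> x powr p)"
          using sets by (intro nn_set_integral_eq_set_integral int2) auto
        moreover have "0 \<le> (LINT x:I|M. \<phi> x powr p)"
          unfolding set_lebesgue_integral_def by (intro Bochner_Integration.integral_nonneg) auto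
        ultimately have "(LINT x:I|M. \<phi> x powr p) / measure M I \<le> c * avg \<phi> I powr p"
          using RH'[OF I] pos \<open>c \<ge> 1\<close> by (simp add: divide_ennreal)
        then show ?thesis using pos by (simp add: field_simps)
      qed
      have conv: "AE x in M. \<forall>\<epsilon>>0. \<exists>\<delta>>0. \<forall>I\<in>T. x \<in> I \<and> 0 < measure M I \<and> measure M I < \<delta> \<longrightarrow>
         \<bar>avg \<phi> I - \<phi> x\<bar> < \<epsilon>"
        using assms(5)[unfolded differentiates_L1_def, rule_format, OF int1] unfolding avg_def .
      note key = integral_excess_le[OF \<open>p > 1\<close> _ _ \<open>c \<ge> 1\<close> nonneg int1 int2 RH_real conv, folded K_def]
      let ?\<psi> = "rearrangement M \<phi>"
      have int_\<psi>: "integrable unit_interval ?\<psi>" "integrable unit_interval (\<lambda>u. ?\<psi> u powr p)"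
        using int1 int2 integrable_rearrangement_iff[of "\<lambda>x. x"] integrable_rearrangement_iff[of "\<lambda>x. x powr p"]
        by simp_all
      let ?a = "LINT u:{0<..t}|unit_interval. ?\<psi> u" and ?b = "LINT u:{0<..t}|unit_interval. ?\<psi> u powr p"
      have nn: "(\<integral>\<^sup>+u\<in>{0<..t}. ennreal (?\<psi> u) \<partial>lborel) = ennreal ?a"
        "(\<integral>\<^sup>+u\<in>{0<..t}. ennreal (?\<psi> u powr p) \<partial>lborel) = ennreal ?b"
        using t rearrangement_nonneg by (auto intro!: nn_integral_initial_segment int_\<psi>)
      have ab: "0 \<le> ?a" "0 \<le> ?b"
        unfolding set_lebesgue_integral_def using t rearrangement_nonneg
        by (auto intro!: Bochner_Integration.integral_nonneg simp: indicator_def)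
      have "?b / t \<le> (K + 1) * (?a / t) powr p"
        using key by (intro rearrangement_reverse_Holder \<open>p > 1\<close> K t int1 int2) auto
      then have "ennreal (?b / t) \<le> ennreal (K + 1) * ennreal ((?a / t) powr p)"
        using K by (simp add: ennreal_leI flip: ennreal_mult del: ennreal_plus)
      then show ?thesis
        unfolding K1 nn using ab t by (simp add: divide_ennreal enn_powr_ennreal del: ennreal_plus)
    qed
  qed
qed

end
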